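(* Let $K$ be the function field of a level $n$ superelliptic curve of genus $g\ge 2$ over $k$, with generators $X,Y$ such that the superelliptic automorphism is $\tau:(X,Y)\mapsto (X,\zeta_n Y)$, and suppose that, for some $m\ge 2$, $\sigma:(X,Y)\mapsto(\zeta_m X,Y)$ defines an automorphism of $K$ over $k$. Let $F$ be the degree $m$ subfield of $K$ fixed by $\sigma$. Then: (i) The generators can be chosen so that $K=k(X,Y)$ with $$Y^n=f(X^m):=X^{\delta m}+a_1X^{(\delta-1)m}+\dots+a_{\delta-1}X^m+1,$$ where $a_1,\dots,a_{\delta-1}\in k$ and the discriminant of the right-hand side is nonzero. (ii) $F=k(U,V)$, where $U=X^m$ and $V=Y$, and $$V^n=f(U).$$ (iii) There is another subfield $L=k(u,v)$ of $K$, where $$u=X^m,\qquad v=X^iY,$$ and $$v^n=u\cdot f(u),$$ for $m=\lambda n$ and $i=\lambda(n-1)$ (with $\lambda$ a positive integer).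
   Context: $k$ is an algebraically closed field whose characteristic is relatively prime to $n$, $n\ge2$; $\zeta_j$ denotes a primitive $j$-th root of unity in $k$. A level $n$ superelliptic curve is a smooth irreducible projective curve $\mathcal X$ over $k$ with an affine equation $y^n=h(x)$, $h\in k[x]$ of nonzero discriminant, for which the order $n$ automorphism $\tau:(x,y)\mapsto(x,\zeta_ny)$ (the superelliptic automorphism) is central in $\mathrm{Aut}(\mathcal X)$; the quotient $\mathcal X/\langle\tau\rangle$ has genus $0$. Its function field $K$ is called a level $n$ superelliptic field. In (i), $f$ denotes the polynomial $f(t)=t^{\delta}+a_1t^{\delta-1}+\dots+a_{\delta-1}t+1$.
   Formalization: In (iii) the printed equation v^n=u·f(u) with i=λ(n-1) fails for n≥3 (e.g. Y^3=X^9+1, m=3); the formal theorem proves v^n=u^{n-1}f(u) for i=λ(n-1), and v^n=u·f(u) for i=λ; both agree with the printed text when n=2. *)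

theory Defs
  imports
    "HOL-Computational_Algebra.Computational_Algebra"
    "HOL-Library.FuncSet"
begin

text \<open>
  The base field \<open>k\<close> is a type \<open>'k\<close> of class \<open>alg_closed_field\<close>, an extension field \<open>K\<close> of it is a
  type \<open>'a\<close> of class \<open>field\<close> together with a homomorphism \<open>\<iota> :: 'k \<Rightarrow> 'a\<close>, and the intermediate
  fields are sets of elements of \<open>'a\<close>.
\<close>

definition field_embedding :: "('k::field \<Rightarrow> 'a::field) \<Rightarrow> bool" where
  "field_embedding \<iota> \<longleftrightarrow>
     \<iota> 1 = 1 \<and> (\<forall>x y. \<iota> (x + y) = \<iota> x + \<iota> y) \<and> (\<forall>x y. \<iota> (x * y) = \<iota> x * \<iota> y)"

definition is_subfield :: "'a::field set \<Rightarrow> bool" where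
  "is_subfield S \<longleftrightarrow>
     1 \<in> S \<and> (\<forall>x\<in>S. \<forall>y\<in>S. x - y \<in> S \<and> x * y \<in> S) \<and> (\<forall>x\<in>S. inverse x \<in> S)"

definition adjoin :: "('k::field \<Rightarrow> 'a::field) \<Rightarrow> 'a set \<Rightarrow> 'a set" where
  "adjoin \<iota> S = is_subfield hull (range \<iota> \<union> S)"

text \<open>\<open>has_degree_over F m\<close> means \<open>[K : F] = m\<close> for the field \<open>K\<close> given by the whole type.\<close>

definition has_degree_over :: "'a::field set \<Rightarrow> nat \<Rightarrow> bool" where
  "has_degree_over F m \<longleftrightarrow>
     (\<exists>B. finite B \<and> card B = m \<and>
       (\<forall>x. \<exists>!c. c \<in> B \<rightarrow>\<^sub>E F \<and> x = (\<Sum>b\<in>B. c b * b)))"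

definition field_auts :: "('k::field \<Rightarrow> 'a::field) \<Rightarrow> ('a \<Rightarrow> 'a) set" where
  "field_auts \<iota> = {\<phi>. bij \<phi> \<and> field_embedding \<phi> \<and> (\<forall>c. \<phi> (\<iota> c) = \<iota> c)}"

definition fixed_field :: "('a::field \<Rightarrow> 'a) \<Rightarrow> 'a set" where
  "fixed_field \<phi> = {x. \<phi> x = x}"

definition primitive_root_of_1 :: "nat \<Rightarrow> 'k::field \<Rightarrow> bool" where
  "primitive_root_of_1 j \<zeta> \<longleftrightarrow> 0 < j \<and> \<zeta> ^ j = 1 \<and> (\<forall>i. 0 < i \<and> i < j \<longrightarrow> \<zeta> ^ i \<noteq> 1)"

abbreviation eval_in :: "('k::field \<Rightarrow> 'a::field) \<Rightarrow> 'k poly \<Rightarrow> 'a \<Rightarrow> 'a" where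
  "eval_in \<iota> p x \<equiv> poly (map_poly \<iota> p) x"

text \<open>
  The discriminant \<open>a\<^sup>2\<^sup>d\<^sup>-\<^sup>2 \<Prod>\<^sub>i\<^sub><\<^sub>j (r\<^sub>i - r\<^sub>j)\<^sup>2\<close> of a polynomial of degree \<open>d\<close> with leading coefficient \<open>a\<close>
  and roots \<open>r\<^sub>1, \<dots>, r\<^sub>d\<close> (listed with multiplicity); the differences are squared, so the order in which
  the list enumerates the roots is immaterial.
\<close>

definition discriminant :: "'k::alg_closed_field poly \<Rightarrow> 'k" where
  "discriminant p =
     (if p = 0 then 0
      else let rs = (SOME rs. mset rs = proots p)
           in lead_coeff p ^ (2 * degree p - 2) *
              (\<Prod>(i, j)\<in>{(i, j). i < j \<and> j < length rs}. (rs ! i - rs ! j) ^ 2))"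


text \<open>
  The places of a function field \<open>K/k\<close> are represented by their normalized discrete valuations. As
  valuations are total functions into \<open>int\<close>, the value at \<open>0\<close> (which should be infinite) is fixed
  arbitrarily to be \<open>0\<close>, so that each place corresponds to exactly one function, and
  \<open>x = 0\<close> is treated separately throughout.
\<close>

definition places :: "('k::field \<Rightarrow> 'a::field) \<Rightarrow> ('a \<Rightarrow> int) set" where
  "places \<iota> = {v. v 0 = 0 \<and>
     (\<forall>x y. x \<noteq> 0 \<and> y \<noteq> 0 \<longrightarrow> v (x * y) = v x + v y) \<and>
     (\<forall>x y. x \<noteq> 0 \<and> y \<noteq> 0 \<and> x + y \<noteq> 0 \<longrightarrow> min (v x) (v y) \<le> v (x + y)) \<and>
     (\<forall>c. c \<noteq> 0 \<longrightarrow> v (\<iota> c) = 0) \<and>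
     (\<exists>x. x \<noteq> 0 \<and> v x = 1)}"

definition divisors :: "('k::field \<Rightarrow> 'a::field) \<Rightarrow> (('a \<Rightarrow> int) \<Rightarrow> int) set" where
  "divisors \<iota> = {D. finite {v. D v \<noteq> 0} \<and> {v. D v \<noteq> 0} \<subseteq> places \<iota>}"

text \<open>Every place has degree \<open>1\<close>, because the base field is algebraically closed.\<close>

definition divisor_degree :: "(('a \<Rightarrow> int) \<Rightarrow> int) \<Rightarrow> int" where
  "divisor_degree D = (\<Sum>v | D v \<noteq> 0. D v)"

definition riemann_roch_space ::
    "('k::field \<Rightarrow> 'a::field) \<Rightarrow> (('a \<Rightarrow> int) \<Rightarrow> int) \<Rightarrow> 'a set" where
  "riemann_roch_space \<iota> D = {x. x = 0 \<or> (\<forall>v\<in>places \<iota>. 0 \<le> v x + D v)}"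

text \<open>
  The genus is \<open>max {deg D - \<ell>(D) + 1 | D a divisor}\<close>; the maximum exists for every function field of
  transcendence degree \<open>1\<close> (Riemann's theorem).
\<close>

definition genus :: "('k::alg_closed_field \<Rightarrow> 'a::field) \<Rightarrow> int" where
  "genus \<iota> =
     (SUP D\<in>divisors \<iota>. divisor_degree D
        - int (vector_space.dim (\<lambda>c x. \<iota> c * x) (riemann_roch_space \<iota> D)) + 1)"


text \<open>
  \<open>K\<close> is the function field of the irreducible curve \<open>y\<^sup>n = h(x)\<close>, with coordinate functions \<open>X, Y\<close>.
  In the irreducibility condition \<open>y\<^sup>n - h(x)\<close> is an element of \<open>k[x][y]\<close>.
\<close>

definition cyclic_curve_field ::
    "('k::alg_closed_field \<Rightarrow> 'a::field) \<Rightarrow> nat \<Rightarrow> 'k poly \<Rightarrow> 'a \<Rightarrow> 'a \<Rightarrow> bool" where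
  "cyclic_curve_field \<iota> n h X Y \<longleftrightarrow>
     field_embedding \<iota> \<and>
     discriminant h \<noteq> 0 \<and>
     irreducible (monom 1 n - [:h:] :: 'k poly poly) \<and>
     adjoin \<iota> {X, Y} = UNIV \<and>
     (\<forall>p. p \<noteq> 0 \<longrightarrow> eval_in \<iota> p X \<noteq> 0) \<and>
     Y ^ n = eval_in \<iota> h X"

text \<open>
  Level \<open>n\<close> superelliptic field. The smooth projective model is determined by \<open>K\<close>, and its
  automorphism group is (anti-isomorphic to) the group of automorphisms of \<open>K\<close> over \<open>k\<close>, so that
  centrality of \<open>\<tau>\<close> can be expressed in the latter. The fixed field of \<open>\<tau>\<close> is \<open>k(X)\<close>, so the
  quotient by \<open>\<tau>\<close> automatically has genus \<open>0\<close>.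
\<close>

definition superelliptic_field ::
    "('k::alg_closed_field \<Rightarrow> 'a::field) \<Rightarrow> nat \<Rightarrow> 'k \<Rightarrow> 'k poly \<Rightarrow> ('a \<Rightarrow> 'a) \<Rightarrow> 'a \<Rightarrow> 'a \<Rightarrow> bool"
  where
  "superelliptic_field \<iota> n \<zeta> h \<tau> X Y \<longleftrightarrow>
     cyclic_curve_field \<iota> n h X Y \<and>
     \<tau> \<in> field_auts \<iota> \<and> \<tau> X = X \<and> \<tau> Y = \<iota> \<zeta> * Y \<and>
     (\<forall>\<phi>\<in>field_auts \<iota>. \<phi> \<circ> \<tau> = \<tau> \<circ> \<phi>)"

text \<open>\<open>t\<^sup>\<delta> + a\<^sub>1 t\<^sup>\<delta>\<^sup>-\<^sup>1 + \<dots> + a\<^sub>\<delta>\<^sub>-\<^sub>1 t + 1\<close>\<close>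

definition normal_poly :: "nat \<Rightarrow> (nat \<Rightarrow> 'k::field) \<Rightarrow> 'k poly" where
  "normal_poly \<delta> a = monom 1 \<delta> + (\<Sum>j=1..<\<delta>. monom (a j) (\<delta> - j)) + 1"

end

theory Submission
  imports Defs
begin

text \<open>
  Applying \<open>\<sigma>\<close> to \<open>Y\<^sub>0\<^sup>n = h(X\<^sub>0)\<close> gives \<open>h(\<zeta>\<^sub>m X\<^sub>0) = h(X\<^sub>0)\<close>, and as \<open>X\<^sub>0\<close> is transcendental this is an
  identity of polynomials: only exponents divisible by \<open>m\<close> occur in \<open>h\<close>. Then \<open>h(0) \<noteq> 0\<close>, for otherwise
  \<open>x\<^sup>m\<close> would divide the separable polynomial \<open>h\<close>; and \<open>h\<close> is not constant, for otherwise \<open>y\<^sup>n - h\<close>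
  would split into linear factors. As both the constant and the leading coefficient of \<open>h\<close> are nonzero
  and \<open>k\<close> contains all roots, rescaling \<open>X\<^sub>0\<close> and \<open>Y\<^sub>0\<close> by constants makes them equal to \<open>1\<close>, which is
  the normal form (\<open>rescale_to_normal_poly\<close>). A rescaling alters neither the eigenvalues of \<open>\<tau>\<close> and
  \<open>\<sigma>\<close> nor the separability of the polynomial.

  The rest is Kummer theory for the eigenvector \<open>X\<close> of \<open>\<sigma>\<close>. The powers
  \<open>1, X, \<dots>, X\<^sup>m\<^sup>-\<^sup>1\<close> are linearly independent over the fixed field of \<open>\<sigma>\<close>, since they belong to
  distinct eigenvalues. On the other
  hand, for a subfield \<open>E\<close> of fixed elements with \<open>X\<^sup>m \<in> E\<close>, the \<open>E\<close>-span of these powers is a ring, and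
  it is a field because the norm \<open>\<Prod>\<^sub>j \<sigma>\<^sup>j(x)\<close> of an element lies in \<open>E\<close>. With \<open>E = k(X\<^sup>m, Y)\<close> the span is
  all of \<open>K\<close>; hence \<open>E\<close> is the whole fixed field and \<open>[K : E] = m\<close>. Finally \<open>X\<^sup>iY\<close> has eigenvalue
  \<open>\<zeta>\<^sub>m\<^sup>i\<close>, so for \<open>0 < i < m\<close> a field containing it is not the fixed field.
\<close>

section \<open>Subfields and homomorphisms of fields\<close>

lemma is_subfield_0: "is_subfield S \<Longrightarrow> 0 \<in> S"
  unfolding is_subfield_def by (metis diff_self)

lemma is_subfield_mult: "is_subfield S \<Longrightarrow> x \<in> S \<Longrightarrow> y \<in> S \<Longrightarrow> x * y \<in> S"
  unfolding is_subfield_def by blast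

lemma is_subfield_inverse: "is_subfield S \<Longrightarrow> x \<in> S \<Longrightarrow> inverse x \<in> S"
  unfolding is_subfield_def by blast

lemma is_subfield_power: "is_subfield S \<Longrightarrow> x \<in> S \<Longrightarrow> x ^ i \<in> S"
  by (induction i) (auto simp: is_subfield_mult is_subfield_def)

lemma is_subfield_adjoin: "is_subfield (adjoin \<iota> S)"
  unfolding adjoin_def by (rule hull_in) (auto simp: is_subfield_def)

lemma adjoin_superset: "range \<iota> \<subseteq> adjoin \<iota> S" "S \<subseteq> adjoin \<iota> S"
  using hull_subset[of "range \<iota> \<union> S" is_subfield] unfolding adjoin_def by auto

lemma adjoin_least: "is_subfield E \<Longrightarrow> range \<iota> \<subseteq> E \<Longrightarrow> S \<subseteq> E \<Longrightarrow> adjoin \<iota> S \<subseteq> E"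
  unfolding adjoin_def by (rule hull_minimal) auto

context
  fixes \<phi> :: "'k::field \<Rightarrow> 'a::field"
  assumes emb: "field_embedding \<phi>"
begin

lemma emb_1: "\<phi> 1 = 1"
  and emb_add: "\<phi> (x + y) = \<phi> x + \<phi> y"
  and emb_mult: "\<phi> (x * y) = \<phi> x * \<phi> y"
  using emb unfolding field_embedding_def by auto

lemma emb_0: "\<phi> 0 = 0"
  by (metis add_cancel_right_right emb_add)

lemma emb_diff: "\<phi> (x - y) = \<phi> x - \<phi> y"
  by (metis emb_add add_diff_cancel_right' diff_add_cancel)

lemma emb_eq_0_iff: "\<phi> x = 0 \<longleftrightarrow> x = 0"
proof
  assume "\<phi> x = 0"
  then have "\<phi> (x * inverse x) = 0" by (simp add: emb_mult)
  then show "x = 0" using emb_1 by (metis right_inverse zero_neq_one)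
qed (simp add: emb_0)

lemma emb_inject: "\<phi> x = \<phi> y \<longleftrightarrow> x = y"
  using emb_eq_0_iff[of "x - y"] by (simp add: emb_diff)

lemma emb_inverse: "\<phi> (inverse x) = inverse (\<phi> x)"
proof (cases "x = 0")
  case False
  then have "\<phi> x * \<phi> (inverse x) = 1" by (simp add: emb_1 flip: emb_mult)
  then show ?thesis by (metis inverse_unique)
qed (simp add: emb_0)

lemma emb_power: "\<phi> (x ^ i) = \<phi> x ^ i"
  by (induction i) (auto simp: emb_1 emb_mult)

lemma emb_sum: "\<phi> (\<Sum>i\<in>A. f i) = (\<Sum>i\<in>A. \<phi> (f i))"
  by (induction A rule: infinite_finite_induct) (auto simp: emb_0 emb_add)

lemma emb_prod: "\<phi> (\<Prod>i\<in>A. f i) = (\<Prod>i\<in>A. \<phi> (f i))"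
  by (induction A rule: infinite_finite_induct) (auto simp: emb_1 emb_mult)

lemma primitive_root_emb: "primitive_root_of_1 j \<zeta> \<Longrightarrow> primitive_root_of_1 j (\<phi> \<zeta>)"
  unfolding primitive_root_of_1_def by (metis emb_1 emb_inject emb_power)

lemma eval_in_0: "eval_in \<phi> 0 x = 0"
  by simp

lemma eval_in_pCons: "eval_in \<phi> (pCons c p) x = \<phi> c + x * eval_in \<phi> p x"
  by (simp add: map_poly_pCons emb_0)

lemma eval_in_add: "eval_in \<phi> (p + q) x = eval_in \<phi> p x + eval_in \<phi> q x"
proof (induction p q rule: poly_induct2)
  case (pCons a p b q)
  then show ?case by (simp only: add_pCons eval_in_pCons emb_add) (simp add: algebra_simps)
qed simp

lemma eval_in_smult: "eval_in \<phi> (smult c p) x = \<phi> c * eval_in \<phi> p x"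
  by (induction p) (simp_all only: smult_pCons eval_in_pCons emb_mult smult_0_right eval_in_0
      mult_zero_right, simp_all add: algebra_simps)

lemma eval_in_diff: "eval_in \<phi> (p - q) x = eval_in \<phi> p x - eval_in \<phi> q x"
  by (metis eval_in_add add_diff_cancel_right' diff_add_cancel)

lemma eval_in_mult: "eval_in \<phi> (p * q) x = eval_in \<phi> p x * eval_in \<phi> q x"
proof (induction p)
  case (pCons a p)
  have "eval_in \<phi> (pCons a p * q) x = eval_in \<phi> (smult a q) x + eval_in \<phi> (pCons 0 (p * q)) x"
    by (simp only: mult_pCons_left eval_in_add)
  then show ?case
    by (simp only: eval_in_smult eval_in_pCons pCons emb_0) (simp add: algebra_simps)
qed simp

lemma eval_in_pcompose: "eval_in \<phi> (p \<circ>\<^sub>p q) x = eval_in \<phi> p (eval_in \<phi> q x)"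
proof (induction p)
  case (pCons a p)
  have "eval_in \<phi> (pCons a p \<circ>\<^sub>p q) x = eval_in \<phi> [:a:] x + eval_in \<phi> (q * p \<circ>\<^sub>p q) x"
    by (simp only: pcompose_pCons eval_in_add)
  then show ?case
    by (simp only: eval_in_mult eval_in_pCons eval_in_0 pCons) simp
qed simp

lemma eval_in_monom: "eval_in \<phi> (monom 1 i) x = x ^ i"
  by (simp add: map_poly_monom emb_0 emb_1 poly_monom)

end

lemma emb_eval_in:
  assumes "field_embedding \<phi>" "field_embedding \<iota>" "\<And>c. \<phi> (\<iota> c) = \<iota> c"
  shows "\<phi> (eval_in \<iota> p x) = eval_in \<iota> p (\<phi> x)"
proof (induction p)
  case (pCons a p)
  then show ?case
    by (simp only: eval_in_pCons[OF assms(2)] emb_add[OF assms(1)] emb_mult[OF assms(1)] assms(3))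
qed (simp add: emb_0[OF assms(1)])

lemma is_subfield_fixed_field:
  assumes "field_embedding \<phi>"
  shows "is_subfield (fixed_field \<phi>)"
  unfolding is_subfield_def fixed_field_def
  by (auto simp: emb_1[OF assms] emb_diff[OF assms] emb_mult[OF assms] emb_inverse[OF assms])

lemma adjoin_rescale_subset:
  shows "adjoin \<iota> {\<iota> a * x, \<iota> b * y} \<subseteq> adjoin \<iota> {x, y}"
proof (rule adjoin_least[OF is_subfield_adjoin adjoin_superset(1)])
  show "{\<iota> a * x, \<iota> b * y} \<subseteq> adjoin \<iota> {x, y}"
    using adjoin_superset[where \<iota> = \<iota> and S = "{x, y}"] is_subfield_mult[OF is_subfield_adjoin[of \<iota> "{x, y}"]]
    by blast
qed

section \<open>Kummer theory of an eigenvector\<close>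

text \<open>
  An automorphism \<open>\<sigma>\<close> with an eigenvector \<open>X\<close> whose eigenvalue \<open>z\<close> is a primitive \<open>m\<close>-th root of
  unity fixed by \<open>\<sigma>\<close>. Over any field of fixed elements that contains \<open>z\<close> and \<open>X\<^sup>m\<close>, the powers of \<open>X\<close>
  then span a cyclic extension of degree \<open>m\<close> with Galois group generated by \<open>\<sigma>\<close>.
\<close>

locale kummer_eigenvector =
  fixes \<sigma> :: "'a::field \<Rightarrow> 'a" and z X :: 'a and m :: nat
  assumes \<sigma>_hom: "field_embedding \<sigma>"
    and z_fixed: "\<sigma> z = z" and z_primitive: "primitive_root_of_1 m z"
    and X_eigen: "\<sigma> X = z * X" and X_nonzero: "X \<noteq> 0"
begin

lemma m_pos: "0 < m"
  using z_primitive by (simp add: primitive_root_of_1_def)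

lemma z_power_m: "z ^ m = 1"
  using z_primitive by (simp add: primitive_root_of_1_def)

lemma inj_on_power_z: "inj_on (\<lambda>j. z ^ j) {..<m}"
proof -
  have "z ^ i \<noteq> z ^ j" if "i < j" "j < m" for i j
  proof
    assume "z ^ i = z ^ j"
    moreover have "z ^ j = z ^ i * z ^ (j - i)" using that by (simp flip: power_add)
    ultimately have "z ^ i * 1 = z ^ i * z ^ (j - i)" by simp
    moreover have "z \<noteq> 0" using z_power_m m_pos by (auto simp: power_0_left)
    ultimately have "z ^ (j - i) = 1" by simp
    then show False using z_primitive that by (auto simp: primitive_root_of_1_def)
  qed
  then show ?thesis by (intro inj_onI) (metis lessThan_iff linorder_neqE_nat)
qed

lemma \<sigma>_iterate_sum:
  assumes "\<And>i. i < m \<Longrightarrow> \<sigma> (c i) = c i"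
  shows "(\<sigma> ^^ j) (\<Sum>i<m. c i * X ^ i) = (\<Sum>i<m. c i * X ^ i * (z ^ j) ^ i)"
proof (induction j)
  case (Suc j)
  have "(\<sigma> ^^ Suc j) (\<Sum>i<m. c i * X ^ i) = (\<Sum>i<m. \<sigma> (c i * X ^ i * (z ^ j) ^ i))"
    using Suc by (simp add: emb_sum[OF \<sigma>_hom])
  also have "\<dots> = (\<Sum>i<m. c i * X ^ i * (z ^ Suc j) ^ i)"
    by (intro sum.cong refl)
      (simp add: assms emb_mult[OF \<sigma>_hom] emb_power[OF \<sigma>_hom] z_fixed X_eigen power_mult_distrib ac_simps)
  finally show ?case .
qed simp

text \<open>
  Applying the powers of \<open>\<sigma>\<close> to a relation \<open>\<Sum>c\<^sub>iX\<^sup>i = 0\<close> shows that the polynomial \<open>\<Sum>(c\<^sub>iX\<^sup>i)t\<^sup>i\<close>, of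
  degree less than \<open>m\<close>, vanishes at the \<open>m\<close> distinct points \<open>1, z, \<dots>, z\<^sup>m\<^sup>-\<^sup>1\<close>.
\<close>

lemma powers_independent:
  assumes fixed: "\<And>i. i < m \<Longrightarrow> \<sigma> (c i) = c i"
    and relation: "(\<Sum>i<m. c i * X ^ i) = 0" and "i < m"
  shows "c i = 0"
proof -
  define p where "p = (\<Sum>i<m. monom (c i * X ^ i) i)"
  have coeff_p: "coeff p i = (if i < m then c i * X ^ i else 0)" for i
    by (simp add: p_def coeff_sum)
  have "poly p (z ^ j) = (\<sigma> ^^ j) 0" for j
    using \<sigma>_iterate_sum[where c = c and j = j, OF fixed] relation by (simp add: p_def poly_sum poly_monom)
  moreover have "(\<sigma> ^^ j) 0 = 0" for j
    by (induction j) (auto simp: emb_0[OF \<sigma>_hom])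
  ultimately have roots: "(\<lambda>j. z ^ j) ` {..<m} \<subseteq> {x. poly p x = 0}"
    by auto
  have "p = 0"
  proof (rule ccontr)
    assume "p \<noteq> 0"
    then have "m \<le> card {x. poly p x = 0}"
      using card_mono[OF _ roots] by (simp add: card_image[OF inj_on_power_z] poly_roots_finite)
    also have "\<dots> \<le> degree p"
      using \<open>p \<noteq> 0\<close> by (rule card_poly_roots_bound)
    also have "degree p < m"
      using \<open>p \<noteq> 0\<close> coeff_p[of "degree p"] leading_coeff_neq_0[OF \<open>p \<noteq> 0\<close>] by (metis)
    finally show False by simp
  qed
  then show ?thesis
    using coeff_p[of i] \<open>i < m\<close> X_nonzero by simp
qed

lemma powers_unique:
  assumes "\<And>i. i < m \<Longrightarrow> \<sigma> (c i) = c i" "\<And>i. i < m \<Longrightarrow> \<sigma> (d i) = d i"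
    and "(\<Sum>i<m. c i * X ^ i) = (\<Sum>i<m. d i * X ^ i)" and "i < m"
  shows "c i = d i"
  using powers_independent[of "\<lambda>i. c i - d i" i] assms
  by (simp add: emb_diff[OF \<sigma>_hom] left_diff_distrib sum_subtractf)

lemma inj_on_power_X: "inj_on (\<lambda>i. X ^ i) {..<m}"
proof (rule inj_onI)
  fix i j assume ij: "i \<in> {..<m}" "j \<in> {..<m}" and eq: "X ^ i = X ^ j"
  have single: "(\<Sum>l<m. (if l = k then 1 else 0) * X ^ l) = X ^ k" if "k < m" for k
    using that by (simp add: if_distrib[of "\<lambda>x. x * _"] cong: if_cong)
  have "(if i = i then 1 else 0 :: 'a) = (if i = j then 1 else 0)"
    by (rule powers_unique[where i = i])
      (use ij eq in \<open>simp_all only: single lessThan_iff\<close>, auto simp: emb_0[OF \<sigma>_hom] emb_1[OF \<sigma>_hom])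
  then show "i = j" by (auto split: if_splits)
qed

definition span_powers :: "'a set \<Rightarrow> 'a set" where
  "span_powers E = {\<Sum>i<m. c i * X ^ i | c. \<forall>i<m. c i \<in> E}"

context
  fixes E :: "'a set"
  assumes E: "is_subfield E" and E_fixed: "E \<subseteq> fixed_field \<sigma>"
    and zE: "z \<in> E" and XmE: "X ^ m \<in> E"
begin

lemma monomial_in_span:
  assumes "c \<in> E"
  shows "c * X ^ k \<in> span_powers E"
proof -
  let ?d = "\<lambda>i. if i = k mod m then c * (X ^ m) ^ (k div m) else 0"
  have "c * X ^ k = c * ((X ^ m) ^ (k div m) * X ^ (k mod m))"
    by (simp flip: power_mult power_add)
  also have "\<dots> = (\<Sum>i<m. ?d i * X ^ i)"
    using m_pos by (simp add: if_distrib[of "\<lambda>x. x * _"] mult.assoc cong: if_cong)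
  finally show ?thesis
    using assms unfolding span_powers_def
    by (intro CollectI exI[of _ ?d]) (auto intro: is_subfield_mult is_subfield_power is_subfield_0 E XmE)
qed

lemma span_diff:
  assumes "x \<in> span_powers E" "y \<in> span_powers E"
  shows "x - y \<in> span_powers E"
proof -
  obtain c d where c: "x = (\<Sum>i<m. c i * X ^ i)" "\<forall>i<m. c i \<in> E"
    and d: "y = (\<Sum>i<m. d i * X ^ i)" "\<forall>i<m. d i \<in> E"
    using assms unfolding span_powers_def by auto
  have "x - y = (\<Sum>i<m. (c i - d i) * X ^ i)"
    by (simp add: c d sum_subtractf left_diff_distrib)
  moreover have "\<forall>i<m. c i - d i \<in> E"
    using c d E by (auto simp: is_subfield_def)
  ultimately show ?thesis
    unfolding span_powers_def by (intro CollectI exI[of _ "\<lambda>i. c i - d i"]) simp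
qed

lemma span_0: "0 \<in> span_powers E"
  using monomial_in_span[OF is_subfield_0[OF E]] by simp

lemma span_add: "x \<in> span_powers E \<Longrightarrow> y \<in> span_powers E \<Longrightarrow> x + y \<in> span_powers E"
  using span_diff[OF _ span_diff[OF span_0]] by fastforce

lemma span_sum: "(\<And>i. i \<in> A \<Longrightarrow> f i \<in> span_powers E) \<Longrightarrow> (\<Sum>i\<in>A. f i) \<in> span_powers E"
  by (induction A rule: infinite_finite_induct) (auto intro: span_0 span_add)

lemma span_mult:
  assumes "x \<in> span_powers E" "y \<in> span_powers E"
  shows "x * y \<in> span_powers E"
proof -
  obtain c d where c: "x = (\<Sum>i<m. c i * X ^ i)" "\<forall>i<m. c i \<in> E"
    and d: "y = (\<Sum>i<m. d i * X ^ i)" "\<forall>i<m. d i \<in> E"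
    using assms unfolding span_powers_def by auto
  have "x * y = (\<Sum>i<m. \<Sum>j<m. (c i * d j) * X ^ (i + j))"
    by (simp add: c d sum_product power_add ac_simps)
  also have "\<dots> \<in> span_powers E"
    by (intro span_sum monomial_in_span is_subfield_mult[OF E]) (use c d in auto)
  finally show ?thesis .
qed

lemma base_in_span: "x \<in> E \<Longrightarrow> x \<in> span_powers E"
  using monomial_in_span[of x 0] by simp

lemma span_prod: "(\<And>i. i \<in> A \<Longrightarrow> f i \<in> span_powers E) \<Longrightarrow> (\<Prod>i\<in>A. f i) \<in> span_powers E"
  using E by (induction A rule: infinite_finite_induct)
    (auto intro: base_in_span span_mult simp: is_subfield_def)

lemma \<sigma>_iterate_span:
  assumes "x \<in> span_powers E"
  shows "(\<sigma> ^^ j) x \<in> span_powers E" and "(\<sigma> ^^ m) x = x"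
proof -
  obtain c where c: "x = (\<Sum>i<m. c i * X ^ i)" "\<forall>i<m. c i \<in> E"
    using assms unfolding span_powers_def by auto
  have iterate: "(\<sigma> ^^ j) x = (\<Sum>i<m. c i * X ^ i * (z ^ j) ^ i)" for j
    unfolding c(1) by (rule \<sigma>_iterate_sum) (use c(2) E_fixed in \<open>auto simp: fixed_field_def\<close>)
  have "(\<sigma> ^^ j) x = (\<Sum>i<m. (c i * (z ^ j) ^ i) * X ^ i)"
    unfolding iterate by (simp add: ac_simps)
  also have "\<dots> \<in> span_powers E"
    using c(2) by (intro span_sum monomial_in_span is_subfield_mult is_subfield_power E zE) auto
  finally show "(\<sigma> ^^ j) x \<in> span_powers E" .
  show "(\<sigma> ^^ m) x = x"
    unfolding iterate z_power_m by (simp add: c(1))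
qed

text \<open>By uniqueness of the coefficients, a fixed element of the span is its own constant term.\<close>

lemma span_fixed:
  assumes "x \<in> span_powers E" "\<sigma> x = x"
  shows "x \<in> E"
proof -
  obtain c where c: "x = (\<Sum>i<m. c i * X ^ i)" "\<forall>i<m. c i \<in> E"
    using assms unfolding span_powers_def by auto
  let ?d = "\<lambda>i :: nat. if i = 0 then x else 0"
  have "(\<Sum>i<m. c i * X ^ i) = (\<Sum>i<m. ?d i * X ^ i)"
    using m_pos by (simp add: if_distrib[of "\<lambda>x. x * _"] c(1)[symmetric] cong: if_cong)
  moreover have "\<sigma> (c i) = c i" if "i < m" for i
    using c(2) E_fixed that by (auto simp: fixed_field_def)
  moreover have "\<sigma> (?d i) = ?d i" for i
    using assms(2) by (simp add: emb_0[OF \<sigma>_hom])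
  ultimately have "c 0 = ?d 0"
    using powers_unique[of c ?d 0, OF _ _ _ m_pos] by simp
  then show ?thesis using c(2) m_pos by auto
qed

text \<open>
  The norm of \<open>x\<close> is fixed by \<open>\<sigma>\<close>, hence lies in \<open>E\<close> and can be inverted there, and the inverse of
  \<open>x\<close> is the product of its other conjugates divided by the norm.
\<close>

lemma span_inverse:
  assumes x: "x \<in> span_powers E"
  shows "inverse x \<in> span_powers E"
proof (cases "x = 0")
  case False
  define N where "N = (\<Prod>j<m. (\<sigma> ^^ j) x)"
  define N' where "N' = (\<Prod>j<m - 1. (\<sigma> ^^ Suc j) x)"
  have N_factor: "N = x * N'"
    using prod.lessThan_Suc_shift[of "\<lambda>j. (\<sigma> ^^ j) x" "m - 1"] m_pos
    by (simp add: N_def N'_def)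
  have N_span: "N \<in> span_powers E" "N' \<in> span_powers E"
    unfolding N_def N'_def by (auto intro!: span_prod \<sigma>_iterate_span(1)[OF x] simp del: funpow.simps)
  have "x * \<sigma> N = (\<sigma> ^^ 0) x * (\<Prod>j<m. (\<sigma> ^^ Suc j) x)"
    by (simp add: N_def emb_prod[OF \<sigma>_hom])
  also have "\<dots> = (\<Prod>j<Suc m. (\<sigma> ^^ j) x)"
    by (rule prod.lessThan_Suc_shift[symmetric])
  also have "\<dots> = x * N"
    using \<sigma>_iterate_span(2)[OF x] by (simp add: N_def)
  finally have "\<sigma> N = N" using False by simp
  then have "N \<in> E" using span_fixed N_span by blast
  have "(\<sigma> ^^ j) x \<noteq> 0" for j
    by (induction j) (auto simp: False emb_eq_0_iff[OF \<sigma>_hom])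
  then have "N \<noteq> 0" by (simp add: N_def)
  then have "inverse x = inverse N * N'"
    using N_factor by (simp add: field_simps)
  then show ?thesis
    using span_mult[OF base_in_span[OF is_subfield_inverse[OF E \<open>N \<in> E\<close>]] N_span(2)] by simp
qed (simp add: span_0)

text \<open>The span is the field \<open>E(X)\<close>.\<close>

lemma is_subfield_span: "is_subfield (span_powers E)"
proof -
  have "1 \<in> span_powers E"
    using E by (intro base_in_span) (simp add: is_subfield_def)
  then show ?thesis
    unfolding is_subfield_def by (blast intro: span_diff span_mult span_inverse)
qed

context
  assumes generated: "\<And>S. is_subfield S \<Longrightarrow> E \<subseteq> S \<Longrightarrow> X \<in> S \<Longrightarrow> S = UNIV"
begin

lemma span_eq_UNIV: "span_powers E = UNIV"
proof (rule generated[OF is_subfield_span])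
  show "E \<subseteq> span_powers E" by (auto intro: base_in_span)
  show "X \<in> span_powers E" using monomial_in_span[of 1 1] E by (simp add: is_subfield_def)
qed

lemma fixed_field_eq: "fixed_field \<sigma> = E"
  using E_fixed span_fixed by (auto simp: span_eq_UNIV fixed_field_def)

lemma degree_eq: "has_degree_over E m"
  unfolding has_degree_over_def
proof (intro exI conjI allI)
  let ?B = "(\<lambda>i. X ^ i) ` {..<m}"
  show "finite ?B" by simp
  show "card ?B = m" using card_image[OF inj_on_power_X] by simp
  have reindex: "(\<Sum>b\<in>?B. c b * b) = (\<Sum>i<m. c (X ^ i) * X ^ i)" for c
    by (simp add: sum.reindex[OF inj_on_power_X])
  fix x
  obtain c where c: "x = (\<Sum>i<m. c i * X ^ i)" "\<forall>i<m. c i \<in> E"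
    using span_eq_UNIV unfolding span_powers_def by blast
  show "\<exists>!c. c \<in> ?B \<rightarrow>\<^sub>E E \<and> x = (\<Sum>b\<in>?B. c b * b)"
  proof (rule ex_ex1I)
    let ?c = "restrict (\<lambda>b. c (the_inv_into {..<m} (\<lambda>i. X ^ i) b)) ?B"
    have c': "?c (X ^ i) = c i" if "i < m" for i
      using that the_inv_into_f_f[OF inj_on_power_X, of i] by simp
    have "?c \<in> ?B \<rightarrow>\<^sub>E E"
    proof (rule PiE_I)
      fix b assume "b \<in> ?B"
      then obtain i where "i < m" "b = X ^ i" by auto
      then show "?c b \<in> E" using c' c(2) by simp
    qed (auto simp: restrict_def)
    moreover have "x = (\<Sum>b\<in>?B. ?c b * b)"
      unfolding reindex c(1) by (intro sum.cong refl) (simp only: c' lessThan_iff)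
    ultimately show "\<exists>c. c \<in> ?B \<rightarrow>\<^sub>E E \<and> x = (\<Sum>b\<in>?B. c b * b)"
      by blast
  next
    fix c d
    assume c: "c \<in> ?B \<rightarrow>\<^sub>E E \<and> x = (\<Sum>b\<in>?B. c b * b)"
      and d: "d \<in> ?B \<rightarrow>\<^sub>E E \<and> x = (\<Sum>b\<in>?B. d b * b)"
    have "c (X ^ i) = d (X ^ i)" if "i < m" for i
    proof (rule powers_unique[of "\<lambda>i. c (X ^ i)" "\<lambda>i. d (X ^ i)", OF _ _ _ that])
      show "(\<Sum>i<m. c (X ^ i) * X ^ i) = (\<Sum>i<m. d (X ^ i) * X ^ i)"
        using c d by (simp flip: reindex)
    qed (use c d E_fixed in \<open>auto simp: fixed_field_def PiE_iff\<close>)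
    then show "c = d"
      using c d by (intro PiE_ext[of c ?B "\<lambda>_. E" d]) auto
  qed
qed

end

end

lemma eigenvalue_moved:
  assumes "0 < i" "i < m" "\<sigma> y = y" "y \<noteq> 0"
  shows "X ^ i * y \<notin> fixed_field \<sigma>"
proof -
  have "\<sigma> (X ^ i * y) = z ^ i * (X ^ i * y)"
    by (simp add: emb_mult[OF \<sigma>_hom] emb_power[OF \<sigma>_hom] X_eigen power_mult_distrib assms)
  moreover have "z ^ i \<noteq> 1"
    using assms z_primitive by (auto simp: primitive_root_of_1_def)
  ultimately show ?thesis
    using X_nonzero assms by (simp add: fixed_field_def)
qed

end

section \<open>The discriminant\<close>

text \<open>
  Simplicity of the roots is expressed by divisibility, since this carries over to substitutions
  directly.
\<close>

lemma discriminant_nonzero_iff: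
  "discriminant p \<noteq> 0 \<longleftrightarrow> p \<noteq> 0 \<and> (\<forall>a. \<not> [:- a, 1:] ^ 2 dvd p)"
proof (cases "p = 0")
  case False
  define rs where "rs = (SOME rs. mset rs = proots p)"
  have rs: "mset rs = proots p"
    unfolding rs_def by (rule someI_ex) (rule ex_mset)
  let ?I = "{(i, j). i < j \<and> j < length rs}"
  have "finite ?I"
    by (rule finite_subset[of _ "{..<length rs} \<times> {..<length rs}"]) auto
  moreover have "discriminant p = lead_coeff p ^ (2 * degree p - 2) * (\<Prod>(i, j)\<in>?I. (rs ! i - rs ! j) ^ 2)"
    using False by (simp add: discriminant_def rs_def Let_def)
  ultimately have "discriminant p \<noteq> 0 \<longleftrightarrow> (\<forall>(i, j)\<in>?I. rs ! i \<noteq> rs ! j)"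
    using False by (auto simp: prod_zero_iff)
  also have "\<dots> \<longleftrightarrow> distinct rs"
    unfolding distinct_conv_nth by (auto simp: neq_iff dest: less_trans) (metis less_trans)+
  also have "\<dots> \<longleftrightarrow> (\<forall>a. count (proots p) a \<le> 1)"
    unfolding distinct_count_atmost_1 rs[symmetric]
    by (auto simp: not_in_iff[symmetric] Suc_le_eq count_eq_zero_iff le_Suc_eq split: if_splits)
  also have "\<dots> \<longleftrightarrow> (\<forall>a. \<not> [:- a, 1:] ^ 2 dvd p)"
    using False by (simp add: order_divides not_le less_Suc_eq_le numeral_2_eq_2 del: power_Suc)
  finally show ?thesis using False by simp
qed (simp add: discriminant_def)

lemma discriminant_rescale:
  fixes p :: "'k::alg_closed_field poly"
  assumes "discriminant p \<noteq> 0" "b \<noteq> 0" "c \<noteq> 0"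
  shows "discriminant (smult c (p \<circ>\<^sub>p [:0, b:])) \<noteq> 0"
  unfolding discriminant_nonzero_iff
proof (intro conjI allI notI)
  \<comment> \<open>Undoing the substitution turns a double root \<open>a\<close> into a double root \<open>ab\<close> of \<open>p\<close>.\<close>
  have unscale: "p = smult (inverse c) (smult c (p \<circ>\<^sub>p [:0, b:]) \<circ>\<^sub>p [:0, inverse b:])"
    using assms by (intro poly_eqI) (simp add: pcompose_smult coeff_pcompose_linear field_simps)
  show False if "smult c (p \<circ>\<^sub>p [:0, b:]) = 0"
    using unscale assms(1) unfolding that by (simp add: discriminant_def)
  fix a assume "[:- a, 1:] ^ 2 dvd smult c (p \<circ>\<^sub>p [:0, b:])"
  then obtain q where q: "smult c (p \<circ>\<^sub>p [:0, b:]) = [:- a, 1:] ^ 2 * q" by (rule dvdE)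
  have root: "[:- a, 1:] \<circ>\<^sub>p [:0, inverse b:] = smult (inverse b) [:- (a * b), 1:]"
    using assms by (simp add: pcompose_pCons)
  have "p = [:- (a * b), 1:] ^ 2 * smult (inverse c * inverse b ^ 2) (q \<circ>\<^sub>p [:0, inverse b:])"
    by (subst unscale) (simp only: q pcompose_mult power2_eq_square root mult_smult_left mult_smult_right smult_smult ac_simps)
  then show False
    using assms(1) unfolding discriminant_nonzero_iff by (metis dvd_triv_left)
qed

section \<open>The normal form of the equation\<close>

text \<open>
  If \<open>h\<close> takes the same value at \<open>x\<close> and at \<open>\<zeta>x\<close> for a transcendental \<open>x\<close>, then \<open>h(\<zeta>t) = h(t)\<close>, and
  comparing coefficients leaves only exponents \<open>i\<close> with \<open>\<zeta>\<^sup>i = 1\<close>.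
\<close>

lemma invariant_exponents:
  assumes \<iota>: "field_embedding \<iota>" and transcendental: "\<And>p. p \<noteq> 0 \<Longrightarrow> eval_in \<iota> p x \<noteq> 0"
    and \<zeta>: "primitive_root_of_1 m \<zeta>"
    and invariant: "eval_in \<iota> h (\<iota> \<zeta> * x) = eval_in \<iota> h x" and "coeff h i \<noteq> 0"
  shows "m dvd i"
proof -
  have "eval_in \<iota> [:0, \<zeta>:] x = \<iota> \<zeta> * x"
    by (simp add: eval_in_pCons[OF \<iota>] emb_0[OF \<iota>] mult.commute del: map_poly_pCons)
  then have "eval_in \<iota> (h \<circ>\<^sub>p [:0, \<zeta>:] - h) x = 0"
    using invariant by (simp only: eval_in_diff[OF \<iota>] eval_in_pcompose[OF \<iota>] diff_self)
  then have "h \<circ>\<^sub>p [:0, \<zeta>:] = h"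
    using transcendental[of "h \<circ>\<^sub>p [:0, \<zeta>:] - h"] by (metis right_minus_eq)
  then have "\<zeta> ^ i * coeff h i = coeff h i"
    by (metis coeff_pcompose_linear)
  then have "\<zeta> ^ i = 1" using \<open>coeff h i \<noteq> 0\<close> by simp
  have "0 < m" "\<zeta> ^ m = 1" using \<zeta> by (auto simp: primitive_root_of_1_def)
  have "\<zeta> ^ i = (\<zeta> ^ m) ^ (i div m) * \<zeta> ^ (i mod m)"
    by (simp flip: power_mult power_add)
  then have "\<zeta> ^ (i mod m) = 1" using \<open>\<zeta> ^ i = 1\<close> \<open>\<zeta> ^ m = 1\<close> by simp
  then have "\<not> 0 < i mod m"
    using \<zeta> \<open>0 < m\<close> by (auto simp: primitive_root_of_1_def)
  then show ?thesis by auto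
qed

text \<open>If \<open>h\<close> is the constant \<open>b\<^sup>n\<close>, then \<open>y - b\<close> is a proper factor of \<open>y\<^sup>n - h\<close>.\<close>

lemma degree_pos_of_irreducible:
  fixes h :: "'k::alg_closed_field poly"
  assumes "2 \<le> n" "irreducible (monom 1 n - [:h:])"
  shows "0 < degree h"
proof (rule ccontr)
  assume "\<not> 0 < degree h"
  then obtain c where c: "h = [:c:]" using degree_0_id[of h] by (metis gr0I)
  obtain b where b: "b ^ n = c" using nth_root_exists[of n c] assms(1) by auto
  have "degree (monom 1 n - [:h:]) = n"
  proof -
    have "degree (monom (1 :: 'k poly) n + - [:h:]) = degree (monom (1 :: 'k poly) n)"
      using assms(1) by (intro degree_add_eq_left) (simp add: degree_monom_eq)
    then show ?thesis unfolding diff_conv_add_uminus by (simp add: degree_monom_eq)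
  qed
  moreover have "poly (monom 1 n - [:h:]) [:b:] = 0"
    by (simp add: poly_monom c poly_const_pow b)
  then obtain q where q: "monom 1 n - [:h:] = [:- [:b:], 1:] * q"
    unfolding poly_eq_0_iff_dvd by (rule dvdE)
  moreover have "\<not> [:- [:b:], 1:] dvd 1"
    by (auto simp: is_unit_poly_iff)
  then have "q dvd 1" using irreducibleD[OF assms(2) q] by blast
  then have "degree q = 0" "q \<noteq> 0" by (auto simp: is_unit_poly_iff)
  ultimately show False using assms(1) by (simp add: degree_mult_eq del: mult_pCons_left)
qed

lemma coeff_pcompose_monom:
  fixes p :: "'k::field poly"
  assumes "0 < m"
  shows "coeff (p \<circ>\<^sub>p monom 1 m) i = (if m dvd i then coeff p (i div m) else 0)"
  using assms
proof (induction p arbitrary: i)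
  case (pCons a p)
  show ?case
  proof (cases "i < m")
    case True
    then show ?thesis
      using pCons.prems by (cases "i = 0") (auto simp: pcompose_pCons coeff_monom_mult coeff_pCons dest: dvd_imp_le split: nat.splits)
  next
    case False
    then have "i = (i - m) + m" by simp
    then obtain j where j: "i = j + m" by blast
    then show ?thesis
      using pCons by (auto simp: pcompose_pCons coeff_monom_mult coeff_pCons split: nat.splits)
  qed
qed simp

lemma coeff_normal_poly:
  assumes "1 \<le> \<delta>"
  shows "coeff (normal_poly \<delta> a) j =
    (if j = 0 \<or> j = \<delta> then 1 else if j < \<delta> then a (\<delta> - j) else 0)"
proof -
  have "(\<Sum>l = 1..<\<delta>. if \<delta> - l = j then a l else 0) = (if 0 < j \<and> j < \<delta> then a (\<delta> - j) else 0)"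
  proof -
    have "(\<Sum>l = 1..<\<delta>. if \<delta> - l = j then a l else 0) =
      (\<Sum>l = 1..<\<delta>. if l = \<delta> - j then if 0 < j \<and> j < \<delta> then a (\<delta> - j) else 0 else 0)"
      by (intro sum.cong refl) auto
    then show ?thesis by auto
  qed
  then show ?thesis
    using assms by (auto simp: normal_poly_def coeff_sum)
qed

text \<open>
  Writing \<open>h = g(t\<^sup>m)\<close> with leading and constant coefficients \<open>c\<close> and \<open>c\<^sub>0\<close>, one takes \<open>b\<close> with
  \<open>b\<^sup>N = c\<^sub>0/c\<close>, where \<open>N\<close> is the degree of \<open>h\<close>, so that \<open>h(bt)\<close> has equal leading and constant
  coefficients.
\<close>

lemma rescale_to_normal_poly:
  fixes h :: "'k::alg_closed_field poly"
  assumes "0 < m" "0 < degree h" "coeff h 0 \<noteq> 0" and exponents: "\<And>i. coeff h i \<noteq> 0 \<Longrightarrow> m dvd i"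
  obtains b \<delta> a where "b \<noteq> 0" "1 \<le> \<delta>"
    "normal_poly \<delta> a \<circ>\<^sub>p monom 1 m = smult (inverse (coeff h 0)) (h \<circ>\<^sub>p [:0, b:])"
proof -
  let ?c0 = "coeff h 0"
  have "lead_coeff h \<noteq> 0" using assms(2) by auto
  obtain \<delta> where \<delta>: "degree h = m * \<delta>"
    using exponents[OF \<open>lead_coeff h \<noteq> 0\<close>] by (rule dvdE)
  then have "1 \<le> \<delta>" using assms(2) by (cases \<delta>) auto
  obtain b where b: "b ^ degree h = ?c0 / lead_coeff h"
    using nth_root_exists[OF assms(2)] by blast
  have "b \<noteq> 0"
    using b assms(2,3) \<open>lead_coeff h \<noteq> 0\<close> by (auto simp: power_0_left)
  define a where "a j = inverse ?c0 * b ^ (m * (\<delta> - j)) * coeff h (m * (\<delta> - j))" for j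
  have "normal_poly \<delta> a \<circ>\<^sub>p monom 1 m = smult (inverse ?c0) (h \<circ>\<^sub>p [:0, b:])"
  proof (rule poly_eqI)
    fix i
    show "coeff (normal_poly \<delta> a \<circ>\<^sub>p monom 1 m) i = coeff (smult (inverse ?c0) (h \<circ>\<^sub>p [:0, b:])) i"
    proof (cases "m dvd i")
      case False
      then have "coeff h i = 0" using exponents by blast
      then show ?thesis
        using False assms(1) by (simp add: coeff_pcompose_monom coeff_pcompose_linear)
    next
      case True
      then obtain j where j: "i = m * j" by (rule dvdE)
      then have lhs: "coeff (normal_poly \<delta> a \<circ>\<^sub>p monom 1 m) i = coeff (normal_poly \<delta> a) j"
        using assms(1) by (simp add: coeff_pcompose_monom)
      consider "j = 0" | "0 < j" "j < \<delta>" | "j = \<delta>" | "\<delta> < j" by linarith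
      then show ?thesis
      proof cases
        case 3
        then show ?thesis
          using \<open>1 \<le> \<delta>\<close> b assms(3) \<open>lead_coeff h \<noteq> 0\<close> unfolding lhs
          by (simp add: coeff_normal_poly coeff_pcompose_linear j flip: \<delta>)
      next
        case 4
        then have "degree h < i" using assms(1) by (simp add: \<delta> j)
        then show ?thesis
          using 4 \<open>1 \<le> \<delta>\<close> unfolding lhs
          by (simp add: coeff_normal_poly coeff_pcompose_linear coeff_eq_0)
      qed (use \<open>1 \<le> \<delta>\<close> assms(3) in
          \<open>simp_all only: lhs, simp_all add: coeff_normal_poly coeff_pcompose_linear j a_def mult.assoc poly_0_coeff_0\<close>)
    qed
  qed
  then show ?thesis using that \<open>b \<noteq> 0\<close> \<open>1 \<le> \<delta>\<close> by blast
qed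

section \<open>Superelliptic fields with an extra automorphism\<close>

theorem theorem3p1:
  fixes \<iota> :: "'k::alg_closed_field \<Rightarrow> 'a::field"
    and n m :: nat and \<zeta>n \<zeta>m :: 'k and h :: "'k poly"
    and \<tau> \<sigma> :: "'a \<Rightarrow> 'a" and X0 Y0 :: 'a and F :: "'a set"
  assumes "n \<ge> 2" and "CHAR('k) = 0 \<or> coprime CHAR('k) n"
    and "primitive_root_of_1 n \<zeta>n"
    and "superelliptic_field \<iota> n \<zeta>n h \<tau> X0 Y0"
    and "genus \<iota> \<ge> 2"
    and "m \<ge> 2" and "primitive_root_of_1 m \<zeta>m"
    and "\<sigma> \<in> field_auts \<iota>" and "\<sigma> X0 = \<iota> \<zeta>m * X0" and "\<sigma> Y0 = Y0"
    and "F = fixed_field \<sigma>"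
  shows "has_degree_over F m \<and>
    (\<exists>X Y \<delta> a f.
       \<comment> \<open>(i)\<close>
       adjoin \<iota> {X, Y} = UNIV \<and>
       \<tau> X = X \<and> \<tau> Y = \<iota> \<zeta>n * Y \<and> \<sigma> X = \<iota> \<zeta>m * X \<and> \<sigma> Y = Y \<and>
       \<delta> \<ge> 1 \<and> f = normal_poly \<delta> a \<and>
       Y ^ n = eval_in \<iota> (f \<circ>\<^sub>p monom 1 m) X \<and>
       discriminant (f \<circ>\<^sub>p monom 1 m) \<noteq> 0 \<and>
       \<comment> \<open>(ii)\<close>
       (let U = X ^ m; V = Y in
          F = adjoin \<iota> {U, V} \<and> V ^ n = eval_in \<iota> f U) \<and>
       \<comment> \<open>(iii)\<close>
       (\<forall>l>0. m = l * n \<longrightarrow>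
          (let u = X ^ m; v = X ^ (l * (n - 1)) * Y; L = adjoin \<iota> {u, v} in
             is_subfield L \<and> L \<noteq> F \<and> v ^ n = u ^ (n - 1) * eval_in \<iota> f u) \<and>
          (let u = X ^ m; v = X ^ l * Y; L = adjoin \<iota> {u, v} in
             is_subfield L \<and> L \<noteq> F \<and> v ^ n = u * eval_in \<iota> f u)))"
proof -
  have \<iota>: "field_embedding \<iota>" and sep: "discriminant h \<noteq> 0"
    and irr: "irreducible (monom 1 n - [:h:])" and gen0: "adjoin \<iota> {X0, Y0} = UNIV"
    and tr: "\<And>p. p \<noteq> 0 \<Longrightarrow> eval_in \<iota> p X0 \<noteq> 0" and eqn0: "Y0 ^ n = eval_in \<iota> h X0"
    and \<tau>: "field_embedding \<tau>" "\<And>c. \<tau> (\<iota> c) = \<iota> c" and \<tau>XY: "\<tau> X0 = X0" "\<tau> Y0 = \<iota> \<zeta>n * Y0"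
    using assms(4) unfolding superelliptic_field_def cyclic_curve_field_def field_auts_def by auto
  have \<sigma>: "field_embedding \<sigma>" "\<And>c. \<sigma> (\<iota> c) = \<iota> c"
    using assms(8) unfolding field_auts_def by auto
  have "0 < m" using assms(6) by simp
  have "h \<noteq> 0" using sep by (auto simp: discriminant_def)

  have "eval_in \<iota> h (\<iota> \<zeta>m * X0) = \<sigma> (Y0 ^ n)"
    unfolding eqn0 by (simp only: emb_eval_in[OF \<sigma>(1) \<iota> \<sigma>(2)] assms(9))
  also have "\<dots> = eval_in \<iota> h X0"
    unfolding emb_power[OF \<sigma>(1)] assms(10) by (rule eqn0)
  finally have "eval_in \<iota> h (\<iota> \<zeta>m * X0) = eval_in \<iota> h X0" .
  then have exponents: "m dvd i" if "coeff h i \<noteq> 0" for i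
    using invariant_exponents[OF \<iota> tr assms(7)] that by blast
  \<comment> \<open>A root at \<open>0\<close> would be a double root, because \<open>m \<ge> 2\<close> rules out a linear term.\<close>
  have c0: "coeff h 0 \<noteq> 0"
  proof
    assume "coeff h 0 = 0"
    moreover have "coeff h 1 = 0" using exponents[of 1] assms(6) by auto
    ultimately have "monom 1 2 dvd h"
      by (auto simp: monom_1_dvd_iff' numeral_2_eq_2 less_Suc_eq)
    then have "[:- 0, 1:] ^ 2 dvd h" by (simp add: monom_altdef)
    then show False using sep unfolding discriminant_nonzero_iff by blast
  qed
  obtain b \<delta> a where "b \<noteq> 0" "1 \<le> \<delta>"
    and f: "normal_poly \<delta> a \<circ>\<^sub>p monom 1 m = smult (inverse (coeff h 0)) (h \<circ>\<^sub>p [:0, b:])"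
    by (rule rescale_to_normal_poly[OF \<open>0 < m\<close> degree_pos_of_irreducible[OF assms(1) irr] c0 exponents])
  \<comment> \<open>The factor \<open>1/h(0)\<close> of the normal form is absorbed by dividing \<open>Y0\<close> by an \<open>n\<close>-th root of \<open>h(0)\<close>.\<close>
  obtain d where d: "d ^ n = coeff h 0"
    using nth_root_exists[of n "coeff h 0"] assms(1) by auto
  then have "d \<noteq> 0" using c0 assms(1) by (auto simp: power_0_left)

  define X where "X = \<iota> (inverse b) * X0"
  define Y where "Y = \<iota> (inverse d) * Y0"
  define f where "f = normal_poly \<delta> a"
  have X0: "X0 = \<iota> b * X" and Y0: "Y0 = \<iota> d * Y"
    using \<open>b \<noteq> 0\<close> \<open>d \<noteq> 0\<close>
    by (simp_all add: X_def Y_def emb_1[OF \<iota>] flip: emb_mult[OF \<iota>] mult.assoc)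
  have gen: "adjoin \<iota> {X, Y} = UNIV"
    using adjoin_rescale_subset[of \<iota> b X d Y] gen0 unfolding X0 Y0 by blast
  have \<tau>': "\<tau> X = X" "\<tau> Y = \<iota> \<zeta>n * Y" and \<sigma>': "\<sigma> X = \<iota> \<zeta>m * X" "\<sigma> Y = Y"
    by (simp_all add: X_def Y_def emb_mult[OF \<tau>(1)] emb_mult[OF \<sigma>(1)] \<tau>(2) \<sigma>(2) \<tau>XY
        assms(9,10) ac_simps)
  have disc: "discriminant (f \<circ>\<^sub>p monom 1 m) \<noteq> 0"
    unfolding f_def f using discriminant_rescale[OF sep \<open>b \<noteq> 0\<close>] c0 by simp
  have "eval_in \<iota> [:0, b:] X = X0"
    by (simp add: X0 eval_in_pCons[OF \<iota>] emb_0[OF \<iota>] mult.commute del: map_poly_pCons)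
  then have "eval_in \<iota> (f \<circ>\<^sub>p monom 1 m) X = \<iota> (inverse (coeff h 0)) * Y0 ^ n"
    unfolding f_def f by (simp only: eval_in_smult[OF \<iota>] eval_in_pcompose[OF \<iota>] eqn0)
  then have eqn: "Y ^ n = eval_in \<iota> (f \<circ>\<^sub>p monom 1 m) X"
    by (simp add: Y_def power_mult_distrib power_inverse d flip: emb_power[OF \<iota>])
  then have eqnU: "Y ^ n = eval_in \<iota> f (X ^ m)"
    by (simp add: eval_in_pcompose[OF \<iota>] eval_in_monom[OF \<iota>])
  have "X0 \<noteq> 0"
    using tr[of "monom 1 1"] by (simp add: eval_in_monom[OF \<iota>])
  have "Y0 \<noteq> 0"
    using tr[OF \<open>h \<noteq> 0\<close>] eqn0 assms(1) by (auto simp: power_0_left)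
  then have "Y \<noteq> 0" using Y0 by auto

  interpret kummer_eigenvector \<sigma> "\<iota> \<zeta>m" X m
    by standard (use \<sigma> \<sigma>' X0 \<open>X0 \<noteq> 0\<close> primitive_root_emb[OF \<iota> assms(7)] in auto)
  define E where "E = adjoin \<iota> {X ^ m, Y}"
  have E: "is_subfield E" "range \<iota> \<subseteq> E" "X ^ m \<in> E" "Y \<in> E"
    using is_subfield_adjoin adjoin_superset[where \<iota> = \<iota> and S = "{X ^ m, Y}"] by (auto simp: E_def)
  have "\<sigma> (X ^ m) = X ^ m"
    by (simp add: emb_power[OF \<sigma>(1)] X_eigen power_mult_distrib z_power_m)
  then have E_fixed: "E \<subseteq> fixed_field \<sigma>"
    unfolding E_def
    by (intro adjoin_least is_subfield_fixed_field \<sigma>(1)) (auto simp: fixed_field_def \<sigma> \<sigma>')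
  have generated: "S = UNIV" if "is_subfield S" "E \<subseteq> S" "X \<in> S" for S
    using adjoin_least[of S \<iota> "{X, Y}"] that E gen by auto
  have zE: "\<iota> \<zeta>m \<in> E" using E(2) by auto
  note kummer = E(1) E_fixed zE E(3) generated
  have F: "F = E"
    unfolding assms(11) by (rule fixed_field_eq[OF kummer])
  have "has_degree_over F m"
    unfolding F by (rule degree_eq[OF kummer])

  \<comment> \<open>To be used for \<open>i = l\<close> and \<open>i = l (n - 1)\<close>, both of which lie strictly between \<open>0\<close> and \<open>m = l n\<close>.\<close>
  have moved: "adjoin \<iota> {X ^ m, X ^ i * Y} \<noteq> F" if "0 < i" "i < m" for i
    using eigenvalue_moved[OF that \<sigma>'(2) \<open>Y \<noteq> 0\<close>] adjoin_superset(2)[of "{X ^ m, X ^ i * Y}" \<iota>]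
    unfolding assms(11) by auto
  have part3: "(X ^ (l * i) * Y) ^ n = (X ^ m) ^ i * eval_in \<iota> f (X ^ m)" if "m = l * n" for l i
    by (simp add: power_mult_distrib that eqnU ac_simps flip: power_mult)
  have "is_subfield (adjoin \<iota> {X ^ m, X ^ (l * (n - 1)) * Y}) \<and>
      adjoin \<iota> {X ^ m, X ^ (l * (n - 1)) * Y} \<noteq> F \<and>
      (X ^ (l * (n - 1)) * Y) ^ n = (X ^ m) ^ (n - 1) * eval_in \<iota> f (X ^ m) \<and>
      is_subfield (adjoin \<iota> {X ^ m, X ^ l * Y}) \<and> adjoin \<iota> {X ^ m, X ^ l * Y} \<noteq> F \<and>
      (X ^ l * Y) ^ n = X ^ m * eval_in \<iota> f (X ^ m)" if "l > 0" "m = l * n" for l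
    using moved[of "l * (n - 1)"] moved[of l] part3[OF that(2), of "n - 1"] part3[OF that(2), of 1]
      that assms(1) is_subfield_adjoin by auto
  then show ?thesis
    using \<open>has_degree_over F m\<close> gen \<tau>' \<sigma>' \<open>1 \<le> \<delta>\<close> f_def eqn disc eqnU F E_def
    unfolding Let_def
    by (intro conjI exI[of _ X] exI[of _ Y] exI[of _ \<delta>] exI[of _ a] exI[of _ f]) simp_all
qed

end
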